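(* Let $N\ge1$ be an integer. Assume that there exists a (non-private) coded caching scheme for $N$ users and $N$ files which achieves the memory-load tradeoff point $(M,R)$ with subpacketization $F$. Then there exists a two-server PIR scheme with $N$ files satisfying the UDIQ condition, with download cost pair $(R_{D_1},R_{D_2})=(M,R)$ and subpacketization $F$.
   Context: **Coded caching scheme for $N$ users and $N$ files.** A server holds $N$ independent files of equal size. Placement: each user $i$ stores a content $Z_i$, a function of the files chosen without knowledge of the demands, of size at most $M$ file sizes. Delivery: for a demand vector $\mathbf d=(d_1,\dots,d_N)$ the server broadcasts a message $X_{\mathbf d}$, a function of the files and $\mathbf d$, of size at most $R$ file sizes for every $\mathbf d$, such that user $i$ recovers $W_{d_i}$ from $X_{\mathbf d}$ and $Z_i$. No privacy is required. **Two-server PIR.** Each of two non-colluding servers stores $N$ files $W_1,\dots,W_N$ of $B$ bits. A user with demand $d\in\{1,\dots,N\}$ sends a query $Q_s^{[d]}\in\mathcal Q_s$ to server $s\in\{1,2\}$, which returns $A_s^{[d]}=\gamma_s(Q_s^{[d]},W_1,\dots,W_N)$. Requirements: $H(W_d\mid A_1^{[d]},A_2^{[d]},Q_1^{[d]},Q_2^{[d]})=0$ and, for $s=1,2$, $I(d;Q_s^{[d]}\mid W_1,\dots,W_N)=0$. The download cost from server $s$ is $R_{D_s}=H(A_s)/B$, the (normalized) size of the answer of server $s$, the metadata being negligible with respect to the file size. **UDIQ (uniform demand and independent queries) condition.** The demand $d$ is uniformly distributed on $\{1,\dots,N\}$ and, with $d$ random, the two queries are independent: $I(Q_1^{[d]};Q_2^{[d]}\mid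 W_1,\dots,W_N)=0$. **Subpacketization** of a scheme is the number of equal-length non-overlapping pieces into which each file is split by the scheme. *)

theory Defs
  imports "HOL-Probability.Probability"
begin

section \<open>Files and packets\<close>

text \<open>Files, users and demands are numbered from 0.  A file is a bit string of length \<open>B\<close>; the
  content of the database is the list of its \<open>N\<close> files.\<close>

definition databases :: "nat \<Rightarrow> nat \<Rightarrow> bool list list set" where
  "databases N B = {W. set W \<subseteq> {w. length w = B} \<and> length W = N}"

text \<open>Splitting a file into \<open>F\<close> consecutive packets of \<open>length w div F\<close> bits; it is only used when
  \<open>F\<close> divides the file length.\<close>

definition packets :: "nat \<Rightarrow> bool list \<Rightarrow> bool list list" where
  "packets F w = map (\<lambda>j. take (length w div F) (drop (j * (length w div F)) w)) [0..<F]"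

definition subpacketization_ok :: "nat \<Rightarrow> nat \<Rightarrow> bool" where
  "subpacketization_ok B F \<longleftrightarrow> 0 < F \<and> F dvd B"


section \<open>Coded caching\<close>

text \<open>All maps of a scheme act on the packets: \<open>S ! n ! j\<close> is packet \<open>j\<close> of file \<open>n\<close>.  The
  argument \<open>d\<close> of the decoder is the whole demand vector, which is public.\<close>

record caching_scheme =
  cc_subpacketization :: nat
  cc_place :: "nat \<Rightarrow> bool list list list \<Rightarrow> bool list"
  cc_deliver :: "nat list \<Rightarrow> bool list list list \<Rightarrow> bool list"
  cc_decode :: "nat \<Rightarrow> nat list \<Rightarrow> bool list \<Rightarrow> bool list \<Rightarrow> bool list list"

definition demand_vectors :: "nat \<Rightarrow> nat \<Rightarrow> nat list set" where
  "demand_vectors K N = {d. set d \<subseteq> {0..<N} \<and> length d = K}"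

definition cache_content :: "caching_scheme \<Rightarrow> nat \<Rightarrow> bool list list \<Rightarrow> bool list" where
  "cache_content C i W = cc_place C i (map (packets (cc_subpacketization C)) W)"

definition broadcast :: "caching_scheme \<Rightarrow> nat list \<Rightarrow> bool list list \<Rightarrow> bool list" where
  "broadcast C d W = cc_deliver C d (map (packets (cc_subpacketization C)) W)"

definition coded_caching :: "nat \<Rightarrow> nat \<Rightarrow> nat \<Rightarrow> caching_scheme \<Rightarrow> bool" where
  "coded_caching K N B C \<longleftrightarrow>
     subpacketization_ok B (cc_subpacketization C) \<and>
     (\<forall>d \<in> demand_vectors K N. \<forall>i < K. \<forall>W \<in> databases N B.
        cc_decode C i d (broadcast C d W) (cache_content C i W)
          = packets (cc_subpacketization C) (W ! (d ! i)))"

text \<open>A content of size \<open>l\<close> bits is an element of \<open>{0,1}\<^sup>l\<close>: the length does not depend on the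
  files, so that it carries no information about them.  Different users (or demand vectors) may
  have different lengths.\<close>

definition achieves_memory_load ::
    "nat \<Rightarrow> nat \<Rightarrow> nat \<Rightarrow> caching_scheme \<Rightarrow> real \<Rightarrow> real \<Rightarrow> bool" where
  "achieves_memory_load K N B C M R \<longleftrightarrow>
     (\<forall>i < K. \<exists>l. real l \<le> M * real B \<and> (\<forall>W \<in> databases N B. length (cache_content C i W) = l)) \<and>
     (\<forall>d \<in> demand_vectors K N.
        \<exists>l. real l \<le> R * real B \<and> (\<forall>W \<in> databases N B. length (broadcast C d W) = l))"


section \<open>Information measures of discrete random variables\<close>

text \<open>The library notions, in bits, for random variables on a discrete probability space \<open>J\<close>.
  Value types are countable, so that the product of two full counting measures is again the full
  counting measure.\<close>

definition pmf_entropy :: "'a pmf \<Rightarrow> ('a \<Rightarrow> 'x::countable) \<Rightarrow> real" where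
  "pmf_entropy J X = prob_space.entropy (measure_pmf J) 2 (count_space UNIV) X"

definition pmf_cond_entropy ::
    "'a pmf \<Rightarrow> ('a \<Rightarrow> 'x::countable) \<Rightarrow> ('a \<Rightarrow> 'y::countable) \<Rightarrow> real" where
  "pmf_cond_entropy J X Y =
     prob_space.conditional_entropy (measure_pmf J) 2 (count_space UNIV) (count_space UNIV) X Y"

definition pmf_cond_mutual_information ::
    "'a pmf \<Rightarrow> ('a \<Rightarrow> 'x::countable) \<Rightarrow> ('a \<Rightarrow> 'y::countable) \<Rightarrow> ('a \<Rightarrow> 'z::countable) \<Rightarrow> real" where
  "pmf_cond_mutual_information J X Y Z =
     prob_space.conditional_mutual_information (measure_pmf J) 2
       (count_space UNIV) (count_space UNIV) (count_space UNIV) X Y Z"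


section \<open>Two-server private information retrieval\<close>

text \<open>The query alphabets are finite and labelled by natural numbers.  \<open>pir_query P d\<close> is the joint
  law of the two queries when the demand is \<open>d\<close>; the user's randomness is independent of the files.
  As above, the answers are computed from the packets.\<close>

record pir_scheme =
  pir_subpacketization :: nat
  pir_query :: "nat \<Rightarrow> (nat \<times> nat) pmf"
  pir_answer1 :: "nat \<Rightarrow> bool list list list \<Rightarrow> bool list"
  pir_answer2 :: "nat \<Rightarrow> bool list list list \<Rightarrow> bool list"

text \<open>An outcome is \<open>(d, W, q\<^sub>1, q\<^sub>2)\<close>.\<close>

type_synonym pir_outcome = "nat \<times> bool list list \<times> nat \<times> nat"

definition pir_joint :: "nat \<Rightarrow> nat \<Rightarrow> pir_scheme \<Rightarrow> nat pmf \<Rightarrow> pir_outcome pmf" where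
  "pir_joint N B P p =
     bind_pmf p (\<lambda>d. bind_pmf (pmf_of_set (databases N B)) (\<lambda>W.
       map_pmf (\<lambda>(q1, q2). (d, W, q1, q2)) (pir_query P d)))"

definition rv_demand :: "pir_outcome \<Rightarrow> nat" where
  "rv_demand = (\<lambda>(d, W, q1, q2). d)"

definition rv_files :: "pir_outcome \<Rightarrow> bool list list" where
  "rv_files = (\<lambda>(d, W, q1, q2). W)"

definition rv_desired :: "pir_outcome \<Rightarrow> bool list" where
  "rv_desired = (\<lambda>(d, W, q1, q2). W ! d)"

definition rv_query1 :: "pir_outcome \<Rightarrow> nat" where
  "rv_query1 = (\<lambda>(d, W, q1, q2). q1)"

definition rv_query2 :: "pir_outcome \<Rightarrow> nat" where
  "rv_query2 = (\<lambda>(d, W, q1, q2). q2)"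

definition rv_answer1 :: "pir_scheme \<Rightarrow> pir_outcome \<Rightarrow> bool list" where
  "rv_answer1 P = (\<lambda>(d, W, q1, q2). pir_answer1 P q1 (map (packets (pir_subpacketization P)) W))"

definition rv_answer2 :: "pir_scheme \<Rightarrow> pir_outcome \<Rightarrow> bool list" where
  "rv_answer2 P = (\<lambda>(d, W, q1, q2). pir_answer2 P q2 (map (packets (pir_subpacketization P)) W))"

text \<open>Correctness and privacy are required for every distribution \<open>p\<close> of the demand.\<close>

definition two_server_pir :: "nat \<Rightarrow> nat \<Rightarrow> pir_scheme \<Rightarrow> bool" where
  "two_server_pir N B P \<longleftrightarrow>
     subpacketization_ok B (pir_subpacketization P) \<and>
     (\<forall>d < N. finite (set_pmf (pir_query P d))) \<and>
     (\<forall>p. set_pmf p \<subseteq> {0..<N} \<longrightarrow>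
        pmf_cond_entropy (pir_joint N B P p) rv_desired
          (\<lambda>\<omega>. (rv_answer1 P \<omega>, rv_answer2 P \<omega>, rv_query1 \<omega>, rv_query2 \<omega>)) = 0 \<and>
        pmf_cond_mutual_information (pir_joint N B P p) rv_demand rv_query1 rv_files = 0 \<and>
        pmf_cond_mutual_information (pir_joint N B P p) rv_demand rv_query2 rv_files = 0)"

definition pir_uniform_joint :: "nat \<Rightarrow> nat \<Rightarrow> pir_scheme \<Rightarrow> pir_outcome pmf" where
  "pir_uniform_joint N B P = pir_joint N B P (pmf_of_set {0..<N})"

definition UDIQ :: "nat \<Rightarrow> nat \<Rightarrow> pir_scheme \<Rightarrow> bool" where
  "UDIQ N B P \<longleftrightarrow>
     pmf_cond_mutual_information (pir_uniform_joint N B P) rv_query1 rv_query2 rv_files = 0"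

text \<open>By privacy the law of an answer does not depend on that of the demand, so taking a uniform
  demand here is no restriction.\<close>

definition download_cost1 :: "nat \<Rightarrow> nat \<Rightarrow> pir_scheme \<Rightarrow> real" where
  "download_cost1 N B P = pmf_entropy (pir_uniform_joint N B P) (rv_answer1 P) / real B"

definition download_cost2 :: "nat \<Rightarrow> nat \<Rightarrow> pir_scheme \<Rightarrow> real" where
  "download_cost2 N B P = pmf_entropy (pir_uniform_joint N B P) (rv_answer2 P) / real B"

end

theory Submission
  imports Defs "HOL-Real_Asymp.Real_Asymp"
begin

text \<open>The user with demand \<open>d\<close> draws a caching user \<open>i\<close> uniformly and asks server 1 for the cache
  content of user \<open>i\<close>, and server 2 for the broadcast of the cyclic demand vector starting at
  \<open>c = d - i\<close> modulo \<open>N\<close>, whose entry at \<open>i\<close> is \<open>d\<close>.  Each of \<open>i\<close> and \<open>c\<close> alone is uniform whatever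
  \<open>d\<close> is, which is privacy, and \<open>(i, c)\<close> is uniform on pairs when \<open>d\<close> is, which is UDIQ.

  The contents are only bounded in size, and their lengths may differ between users, so that the
  entropy of a content chosen at random could exceed the bound.  Each content is therefore padded to
  a common length.  The costs are then raised to exactly \<open>M\<close> and \<open>R\<close> by letting each query carry
  an independent random key of a prescribed entropy, which the server appends to its answer.\<close>

section \<open>Entropy of finitely supported distributions\<close>

text \<open>Entropy in bits as a plain sum. An infinite support would make the sum 0 by convention,
  so it is used for finitely supported laws.\<close>

definition shannon :: "'a pmf \<Rightarrow> real" where
  "shannon p = - (\<Sum>x\<in>set_pmf p. pmf p x * log 2 (pmf p x))"

lemma shannon_sum:
  assumes "finite A" "set_pmf p \<subseteq> A"
  shows "shannon p = - (\<Sum>x\<in>A. pmf p x * log 2 (pmf p x))"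
  unfolding shannon_def
  by (subst sum.mono_neutral_left[OF assms]) (auto simp: set_pmf_iff)

lemma shannon_map_inj:
  assumes "inj_on f (set_pmf p)"
  shows "shannon (map_pmf f p) = shannon p"
  by (simp add: shannon_def sum.reindex[OF assms] pmf_map_inj[OF assms])

lemma shannon_pair:
  assumes "finite (set_pmf p)" "finite (set_pmf q)"
  shows "shannon (pair_pmf p q) = shannon p + shannon q"
proof -
  have sp: "(\<Sum>x\<in>set_pmf p. pmf p x) = 1" and sq: "(\<Sum>x\<in>set_pmf q. pmf q x) = 1"
    using assms by (simp_all add: sum_pmf_eq_1)
  have "(\<Sum>z\<in>set_pmf p \<times> set_pmf q. pmf (pair_pmf p q) z * log 2 (pmf (pair_pmf p q) z))
      = (\<Sum>x\<in>set_pmf p. \<Sum>y\<in>set_pmf q. pmf p x * pmf q y * log 2 (pmf p x * pmf q y))"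
    by (subst sum.cartesian_product, rule sum.cong) (auto simp: pmf_pair)
  also have "\<dots> = (\<Sum>x\<in>set_pmf p. \<Sum>y\<in>set_pmf q.
      pmf p x * log 2 (pmf p x) * pmf q y + pmf p x * (pmf q y * log 2 (pmf q y)))"
    by (intro sum.cong refl) (auto simp: log_mult pmf_positive algebra_simps set_pmf_iff)
  also have "\<dots> = (\<Sum>x\<in>set_pmf p. pmf p x * log 2 (pmf p x))
      + (\<Sum>y\<in>set_pmf q. pmf q y * log 2 (pmf q y))"
    by (simp add: sum.distrib sum_distrib_left[symmetric] sum_distrib_right[symmetric] sp sq)
  finally show ?thesis by (simp add: shannon_def)
qed

section \<open>The measure-theoretic entropy as a finite sum, and its upper bound\<close>

lemma countable_pair_count_space:
  "count_space (UNIV :: 'x::countable set) \<Otimes>\<^sub>M count_space (UNIV :: 'y::countable set)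
     = count_space UNIV"
  by (simp add: pair_measure_countable)

lemma sigma_finite_countable:
  "sigma_finite_measure (count_space (UNIV :: 'x::countable set))"
  by (simp add: sigma_finite_measure_count_space_countable)

lemma distr_measure_pmf: "distr (measure_pmf J) (count_space UNIV) X = measure_pmf (map_pmf X J)"
  by (simp add: map_pmf_rep_eq)

lemma distributed_pmf:
  "distributed (measure_pmf J) (count_space UNIV) X (pmf (map_pmf X J))"
  unfolding distributed_def distr_measure_pmf measure_pmf_eq_density[symmetric] by simp

lemma information_space_pmf: "information_space (measure_pmf J) 2"
  by (simp add: information_space_def information_space_axioms_def prob_space_measure_pmf)

lemma pmf_entropy_eq_shannon:
  assumes "finite (set_pmf J)"
  shows "pmf_entropy J X = shannon (map_pmf X J)"
proof -
  have fin: "finite (set_pmf (map_pmf X J))" using assms by simp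
  interpret information_space "measure_pmf J" 2 by (rule information_space_pmf)
  show ?thesis
    unfolding pmf_entropy_def shannon_def
    by (subst entropy_distr[OF distributed_pmf], simp,
        subst lebesgue_integral_count_space_finite_support)
       (auto intro!: finite_subset[OF _ fin] sum.mono_neutral_left fin simp: set_pmf_iff
             simp del: set_map_pmf)
qed

text \<open>Among laws on a finite set the uniform one has the largest entropy. The bound
  \<open>entropy_le\<close>, applied to the identity variable, gives the logarithm of the size of
  the support, which lies in \<open>A\<close>.\<close>

lemma shannon_le_log_card:
  fixes p :: "'a::countable pmf"
  assumes "finite A" "set_pmf p \<subseteq> A"
  shows "shannon p \<le> log 2 (card A)"
proof -
  interpret information_space "measure_pmf p" 2 by (rule information_space_pmf)
  have fin: "finite (set_pmf p)" using assms finite_subset by blast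
  have supp: "{x. pmf p x \<noteq> 0} = set_pmf p" by (auto simp: set_pmf_iff)
  have d: "distributed (measure_pmf p) (count_space UNIV) (\<lambda>x. x) (pmf p)"
    using distributed_pmf[of p "\<lambda>x. x"] by simp
  have "prob_space.entropy (measure_pmf p) 2 (count_space UNIV) (\<lambda>x. x)
      \<le> log 2 (measure (count_space UNIV) {x \<in> space (count_space UNIV). pmf p x \<noteq> 0})"
  proof (rule entropy_le[OF d])
    show "integrable (count_space UNIV) (\<lambda>x. - pmf p x * log 2 (pmf p x))"
      unfolding abs_summable_on_def[symmetric]
      by (subst abs_summable_on_cong_neutral[where B = "set_pmf p"])
         (use fin in \<open>auto simp: set_pmf_iff\<close>)
  qed (use fin in \<open>simp_all add: supp\<close>)
  also have "\<dots> = log 2 (card (set_pmf p))"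
    using fin by (simp add: supp)
  also have "\<dots> \<le> log 2 (card A)"
  proof -
    \<comment> \<open>The logarithm is monotone only on positive arguments, so an empty support has
      to be excluded.\<close>
    have "0 < card (set_pmf p)" using fin by (simp add: card_gt_0_iff set_pmf_not_empty)
    then show ?thesis using card_mono[OF assms] by simp
  qed
  finally show ?thesis
    using pmf_entropy_eq_shannon[of p "\<lambda>x. x"] fin by (simp add: pmf_entropy_def)
qed

section \<open>Distributions of prescribed entropy\<close>

lemma continuous_on_mult_ln: "continuous_on {0..} (\<lambda>x::real. x * ln x)"
  unfolding continuous_on_def
proof
  fix x :: real assume x: "x \<in> {0..}"
  show "((\<lambda>x. x * ln x) \<longlongrightarrow> x * ln x) (at x within {0..})"
  proof (cases "x = 0")
    case True
    \<comment> \<open>At 0 the expression evaluates to 0, which agrees with its limit from the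
      right.\<close>
    have "((\<lambda>x::real. x * ln x) \<longlongrightarrow> 0) (at_right 0)" by real_asymp
    moreover have "at (0::real) within {0..} = at_right 0"
      by (metis at_within_Ici_at_right)
    ultimately show ?thesis using True by simp
  next
    case False
    then show ?thesis using x by (intro tendsto_intros) auto
  qed
qed

text \<open>The binary entropy function is continuous on [0, 1/2] and runs from 0 to 1, so the
  intermediate value theorem applies.\<close>

lemma bernoulli_entropy_surj:
  assumes "0 \<le> h" "h \<le> 1"
  obtains q :: "bool pmf" where "shannon q = h"
proof -
  let ?f = "\<lambda>t::real. - (t * ln t + (1 - t) * ln (1 - t)) / ln 2"
  have 1: "continuous_on {0..1/2} (\<lambda>x::real. x * ln x)"
    by (rule continuous_on_subset[OF continuous_on_mult_ln]) auto
  have 2: "continuous_on {0..1/2} (\<lambda>t::real. (1 - t) * ln (1 - t))"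
    by (rule continuous_on_compose2[OF continuous_on_mult_ln, where f = "\<lambda>t. 1 - t"])
       (auto intro!: continuous_intros)
  have "continuous_on {0..1/2} ?f"
    by (intro continuous_intros 1 2) auto
  moreover have "?f 0 \<le> h" "h \<le> ?f (1/2)"
    using assms by (simp_all add: ln_div)
  ultimately obtain t where t: "0 \<le> t" "t \<le> 1/2" "?f t = h"
    using IVT'[of ?f 0 h "1/2"] by auto
  have "shannon (bernoulli_pmf t) = h"
    using t by (subst shannon_sum[of UNIV]) (auto simp: UNIV_bool log_def field_simps)
  then show thesis by (rule that)
qed

text \<open>The bits are chosen independently, so their entropies add: the first bit carries
  \<open>min h 1\<close>, and the remaining ones carry the rest by induction.\<close>

lemma ex_pmf_shannon:
  assumes "0 \<le> h" "h \<le> real n"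
  shows "\<exists>K :: bool list pmf. set_pmf K \<subseteq> {k. length k = n} \<and> shannon K = h"
  using assms
proof (induction n arbitrary: h)
  case 0
  then show ?case
    by (intro exI[of _ "return_pmf []"]) (auto simp: shannon_def)
next
  case (Suc n)
  define x where "x = min h 1"
  obtain q :: "bool pmf" where q: "shannon q = x"
    using bernoulli_entropy_surj[of x] Suc.prems by (auto simp: x_def)
  have "0 \<le> h - x" "h - x \<le> real n"
    using Suc.prems by (auto simp: x_def min_def)
  then obtain K :: "bool list pmf" where K: "set_pmf K \<subseteq> {k. length k = n}" "shannon K = h - x"
    using Suc.IH by blast
  have "finite (set_pmf K)"
    using K(1) finite_subset finite_lists_length_eq[of "UNIV :: bool set" n] by auto
  moreover have "inj_on (\<lambda>(b, k). b # k) (set_pmf (pair_pmf q K))"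
    by (auto simp: inj_on_def)
  ultimately have "shannon (map_pmf (\<lambda>(b, k). b # k) (pair_pmf q K)) = h"
    by (subst shannon_map_inj) (simp_all add: shannon_pair q K)
  then show ?case
    using K(1) by (intro exI[of _ "map_pmf (\<lambda>(b, k). b # k) (pair_pmf q K)"]) auto
qed


section \<open>Conditional entropy and independence\<close>

text \<open>The joint law lives on the graph of \<open>g\<close>. There p(x, y) = p(y), so the
  logarithm of the ratio vanishes where p(y) is positive; everywhere else the factor p(x, y) is
  0.\<close>

lemma pmf_cond_entropy_eq_0:
  assumes fin: "finite (set_pmf J)"
    and g: "\<And>\<omega>. \<omega> \<in> set_pmf J \<Longrightarrow> X \<omega> = g (Y \<omega>)"
  shows "pmf_cond_entropy J X Y = 0"
proof -
  interpret information_space "measure_pmf J" 2 by (rule information_space_pmf)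
  let ?XY = "\<lambda>\<omega>. (X \<omega>, Y \<omega>)"
  have XY: "map_pmf ?XY J = map_pmf (\<lambda>y. (g y, y)) (map_pmf Y J)"
    unfolding map_pmf_comp by (rule map_pmf_cong) (auto simp: g)
  have zero: "pmf (map_pmf ?XY J) (x, y) * log 2 (pmf (map_pmf ?XY J) (x, y) / pmf (map_pmf Y J) y) = 0"
    for x y
  proof (cases "x = g y")
    case True
    have "pmf (map_pmf ?XY J) (g y, y) = pmf (map_pmf Y J) y"
      unfolding XY using pmf_map_inj'[of "\<lambda>y. (g y, y)" "map_pmf Y J" y] by (auto simp: inj_def)
    with True show ?thesis by simp
  next
    case False
    then have "pmf (map_pmf ?XY J) (x, y) = 0"
      unfolding XY by (intro pmf_map_outside) auto
    then show ?thesis by simp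
  qed
  show ?thesis
    unfolding pmf_cond_entropy_def
    by (subst conditional_entropy_generic_eq[where Py = "pmf (map_pmf Y J)"
          and Pxy = "pmf (map_pmf ?XY J)"])
       (simp_all add: sigma_finite_countable distributed_pmf countable_pair_count_space zero
          case_prod_unfold del: mult_eq_0_iff)
qed

section \<open>Independence and vanishing mutual information\<close>

lemma measure_pair_pmf:
  fixes p :: "'x::countable pmf" and q :: "'y::countable pmf"
  shows "measure_pmf (pair_pmf p q) = measure_pmf p \<Otimes>\<^sub>M measure_pmf q"
proof -
  have "measure_pmf p \<Otimes>\<^sub>M measure_pmf q
      = density (count_space UNIV \<Otimes>\<^sub>M count_space UNIV) (\<lambda>(x, y). ennreal (pmf p x) * ennreal (pmf q y))"
    unfolding measure_pmf_eq_density[of p] measure_pmf_eq_density[of q]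
    by (rule pair_measure_density)
       (simp_all add: sigma_finite_countable measure_pmf_eq_density[symmetric]
          measure_pmf.sigma_finite_measure_axioms)
  also have "\<dots> = measure_pmf (pair_pmf p q)"
    unfolding measure_pmf_eq_density[of "pair_pmf p q"] countable_pair_count_space
    by (rule density_cong) (auto simp: pmf_pair ennreal_mult)
  finally show ?thesis by simp
qed

text \<open>Mutual information is the divergence of the joint law from the product of its marginals.
  Here the marginals are \<open>p\<close> and \<open>q\<close>, and the two measures
  coincide.\<close>

lemma mutual_information_pmf_eq_0:
  fixes X :: "'a \<Rightarrow> 'x::countable" and Y :: "'a \<Rightarrow> 'y::countable"
  assumes "map_pmf (\<lambda>\<omega>. (X \<omega>, Y \<omega>)) J = pair_pmf p q"
  shows "prob_space.mutual_information (measure_pmf J) 2 (count_space UNIV) (count_space UNIV) X Y = 0"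
proof -
  interpret information_space "measure_pmf J" 2 by (rule information_space_pmf)
  have p: "map_pmf X J = p" and q: "map_pmf Y J = q"
    using arg_cong[OF assms, of "map_pmf fst"] arg_cong[OF assms, of "map_pmf snd"]
    by (simp_all add: map_pmf_comp map_fst_pair_pmf map_snd_pair_pmf)
  show ?thesis
    unfolding prob_space.mutual_information_def[OF prob_space_measure_pmf] countable_pair_count_space distr_measure_pmf assms p q
      measure_pair_pmf[symmetric]
    by (rule sigma_finite_measure.KL_same_eq_0[OF measure_pmf.sigma_finite_measure_axioms])
qed

text \<open>By definition this is I(X; (Y, Z)) - I(X; Z). Under full independence of the three
  variables both terms are 0.\<close>

lemma pmf_cond_mutual_information_eq_0:
  assumes "map_pmf (\<lambda>\<omega>. (X \<omega>, Y \<omega>, Z \<omega>)) J = pair_pmf p (pair_pmf q r)"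
  shows "pmf_cond_mutual_information J X Y Z = 0"
proof -
  interpret information_space "measure_pmf J" 2 by (rule information_space_pmf)
  have "map_pmf (\<lambda>\<omega>. (X \<omega>, Z \<omega>)) J = map_pmf (\<lambda>(x, y, z). (x, z)) (pair_pmf p (pair_pmf q r))"
    unfolding assms[symmetric] by (simp add: map_pmf_comp)
  also have "\<dots> = map_pmf (\<lambda>(x, y). (id x, snd y)) (pair_pmf p (pair_pmf q r))"
    by (rule map_pmf_cong) auto
  also have "\<dots> = pair_pmf p r"
    by (simp add: map_pair map_snd_pair_pmf)
  finally show ?thesis
    using mutual_information_pmf_eq_0[of X "\<lambda>\<omega>. (Y \<omega>, Z \<omega>)" J] assms
      mutual_information_pmf_eq_0[of X Z J]
    unfolding pmf_cond_mutual_information_def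
      prob_space.conditional_mutual_information_def[OF prob_space_measure_pmf]
      countable_pair_count_space by simp
qed

text \<open>For use with \<open>G\<close> the law of demand and queries and \<open>D\<close> that of
  the files: two independent quantities on the user's side remain mutually independent together with
  the files.\<close>

lemma map_pair_pmf_indep:
  assumes "map_pmf (\<lambda>g. (f g, h g)) G = pair_pmf p q"
  shows "map_pmf (\<lambda>(g, w). (f g, h g, w)) (pair_pmf G D) = pair_pmf p (pair_pmf q D)"
proof -
  have "map_pmf (\<lambda>(g, w). (f g, h g, w)) (pair_pmf G D)
      = map_pmf (\<lambda>((x, y), w). (x, y, w)) (pair_pmf (map_pmf (\<lambda>g. (f g, h g)) G) D)"
    by (simp add: pair_map_pmf1 map_pmf_comp split_def)
  then show ?thesis
    unfolding assms pair_pair_pmf by (simp add: map_pmf_comp split_def)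
qed


section \<open>From caching to private retrieval\<close>

text \<open>The queries depend on the demand but not on the files, so the files can be drawn last.
  This exhibits the joint law as a product.\<close>

lemma pir_joint_eq:
  "pir_joint N B P p = map_pmf (\<lambda>((d, q1, q2), W). (d, W, q1, q2))
     (pair_pmf (bind_pmf p (\<lambda>d. map_pmf (Pair d) (pir_query P d))) (pmf_of_set (databases N B)))"
  unfolding pir_joint_def pair_pmf_def map_pmf_def
  by (simp add: bind_assoc_pmf bind_return_pmf split_def)
     (subst bind_commute_pmf, rule refl)

lemma finite_databases: "finite (databases N B)"
proof -
  have "finite {w :: bool list. length w = B}"
    using finite_lists_length_eq[of "UNIV :: bool set" B] by simp
  then show ?thesis
    unfolding databases_def by (rule finite_lists_length_eq)
qed

lemma databases_nonempty: "databases N B \<noteq> {}"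
  by (auto simp: databases_def intro!: exI[of _ "replicate N (replicate B False)"])

section \<open>Packets and padding\<close>

lemma concat_take_drop:
  "concat (map (\<lambda>j. take b (drop (j * b) w)) [0..<n]) = take (n * b) w"
  by (induction n) (simp_all add: take_add[symmetric] add.commute)

lemma concat_packets:
  assumes "F dvd length w"
  shows "concat (packets F w) = w"
  using assms by (simp add: packets_def concat_take_drop)

definition pad :: "nat \<Rightarrow> bool list \<Rightarrow> bool list" where
  "pad l z = z @ replicate (l - length z) False"

lemma length_pad: "length z \<le> l \<Longrightarrow> length (pad l z) = l"
  by (simp add: pad_def)

text \<open>Whoever knows the unpadded length can strip the zeros and the key \<open>k\<close> in
  one cut.\<close>

lemma take_pad: "length z = m \<Longrightarrow> take m (pad l z @ k) = z"
  by (simp add: pad_def)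

section \<open>Cyclic demand vectors and the law of the queries\<close>

definition cyclic_demand :: "nat \<Rightarrow> nat \<Rightarrow> nat list" where
  "cyclic_demand N c = map (\<lambda>i. (c + i) mod N) [0..<N]"

lemma cyclic_demand_in: "N \<ge> 1 \<Longrightarrow> cyclic_demand N c \<in> demand_vectors N N"
  by (auto simp: cyclic_demand_def demand_vectors_def)

text \<open>Adding \<open>N - i\<close> is subtraction of \<open>i\<close> modulo \<open>N\<close>,
  in a form that avoids truncation at 0 when d < i.\<close>

lemma cyclic_demand_nth: "i < N \<Longrightarrow> cyclic_demand N ((d + (N - i)) mod N) ! i = d mod N"
  by (simp add: cyclic_demand_def mod_simps)

text \<open>For a fixed caching user the offset is uniform when the demand is; this yields
  independence of the queries.\<close>

lemma bij_betw_shift: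
  fixes N i :: nat
  assumes "N \<ge> 1" "i < N"
  shows "bij_betw (\<lambda>d. (d + (N - i)) mod N) {0..<N} {0..<N}"
proof (rule bij_betw_byWitness[where f' = "\<lambda>c. (c + i) mod N"])
  show "\<forall>d\<in>{0..<N}. ((d + (N - i)) mod N + i) mod N = d"
    using assms by (simp add: mod_simps)
  show "\<forall>c\<in>{0..<N}. ((c + i) mod N + (N - i)) mod N = c"
    using assms by (auto simp: mod_add_left_eq add.assoc simp del: add_diff_assoc)
qed (use assms in auto)

text \<open>For a fixed demand the offset is uniform when the caching user is; this yields privacy
  against server 2. The map i -> d - i modulo \<open>N\<close> is its own inverse.\<close>

lemma bij_betw_shift_flip:
  fixes N d :: nat
  assumes "N \<ge> 1" "d < N"
  shows "bij_betw (\<lambda>i. (d + (N - i)) mod N) {0..<N} {0..<N}"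
proof (rule bij_betw_byWitness[where f' = "\<lambda>i. (d + (N - i)) mod N"])
  have "(d + (N - (d + (N - i)) mod N)) mod N = i" if "i < N" for i
  proof (cases "i \<le> d")
    case True
    then have "(d + (N - i)) mod N = d - i"
      using that assms by (simp add: mod_if)
    then show ?thesis using True that assms by (simp add: mod_if)
  next
    case False
    then have "(d + (N - i)) mod N = d + (N - i)"
      using that assms by (simp add: mod_if)
    then show ?thesis using False that assms by (simp add: mod_if)
  qed
  then show "\<forall>i\<in>{0..<N}. (d + (N - (d + (N - i)) mod N)) mod N = i"
    "\<forall>i\<in>{0..<N}. (d + (N - (d + (N - i)) mod N)) mod N = i" by auto
qed (use assms in auto)

text \<open>The query alphabet consists of natural numbers, hence \<open>to_nat\<close>. The keys
  travel inside the queries, so that each answer is a function of query and files.\<close>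

definition caching_query :: "nat \<Rightarrow> bool list pmf \<Rightarrow> bool list pmf \<Rightarrow> nat \<Rightarrow> (nat \<times> nat) pmf" where
  "caching_query N K L d = map_pmf (\<lambda>(i, k, k'). (to_nat (i, k), to_nat ((d + (N - i)) mod N, k')))
     (pair_pmf (pmf_of_set {0..<N}) (pair_pmf K L))"

definition key_query :: "nat \<Rightarrow> bool list pmf \<Rightarrow> nat pmf" where
  "key_query N K = map_pmf to_nat (pair_pmf (pmf_of_set {0..<N}) K)"

lemma map_fst_caching_query: "map_pmf fst (caching_query N K L d) = key_query N K"
proof -
  have "map_pmf fst (caching_query N K L d)
      = map_pmf to_nat (map_pmf (\<lambda>(i, y). (id i, fst y)) (pair_pmf (pmf_of_set {0..<N}) (pair_pmf K L)))"
    by (simp add: caching_query_def map_pmf_comp split_def)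
  then show ?thesis
    unfolding map_pair by (simp add: map_fst_pair_pmf key_query_def)
qed

lemma map_snd_caching_query:
  assumes "N \<ge> 1" "d < N"
  shows "map_pmf snd (caching_query N K L d) = key_query N L"
proof -
  have "map_pmf snd (caching_query N K L d)
      = map_pmf to_nat (map_pmf (\<lambda>(i, y). ((d + (N - i)) mod N, snd y))
          (pair_pmf (pmf_of_set {0..<N}) (pair_pmf K L)))"
    by (simp add: caching_query_def map_pmf_comp split_def)
  then show ?thesis
    unfolding map_pair using assms
    by (simp add: map_snd_pair_pmf key_query_def map_pmf_of_set_bij_betw[OF bij_betw_shift_flip])
qed

text \<open>Draw the caching user before the demand: given \<open>i\<close>, the offset is uniform,
  so it may be replaced by an independent uniform \<open>c\<close>. Regrouping the draws then
  separates the two queries.\<close>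

lemma caching_query_uniform:
  assumes "N \<ge> 1"
  shows "bind_pmf (pmf_of_set {0..<N}) (caching_query N K L)
    = pair_pmf (key_query N K) (key_query N L)"
proof -
  let ?U = "pmf_of_set {0..<N}"
  have "bind_pmf ?U (caching_query N K L)
     = bind_pmf ?U (\<lambda>i. bind_pmf (map_pmf (\<lambda>d. (d + (N - i)) mod N) ?U) (\<lambda>c.
         bind_pmf K (\<lambda>k. bind_pmf L (\<lambda>k'. return_pmf (to_nat (i, k), to_nat (c, k'))))))"
    unfolding caching_query_def pair_pmf_def map_pmf_def
    by (simp add: bind_assoc_pmf bind_return_pmf) (subst bind_commute_pmf, rule refl)
  also have "\<dots> = bind_pmf ?U (\<lambda>i. bind_pmf ?U (\<lambda>c.
         bind_pmf K (\<lambda>k. bind_pmf L (\<lambda>k'. return_pmf (to_nat (i, k), to_nat (c, k'))))))"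
    using assms by (intro bind_pmf_cong refl)
      (simp add: map_pmf_of_set_bij_betw[OF bij_betw_shift] del: add_diff_assoc)
  also have "\<dots> = bind_pmf ?U (\<lambda>i. bind_pmf K (\<lambda>k. bind_pmf ?U (\<lambda>c.
         bind_pmf L (\<lambda>k'. return_pmf (to_nat (i, k), to_nat (c, k'))))))"
    by (subst bind_commute_pmf[of K]) (rule refl)
  also have "\<dots> = pair_pmf (key_query N K) (key_query N L)"
    unfolding key_query_def pair_pmf_def map_pmf_def
    by (simp add: bind_assoc_pmf bind_return_pmf)
  finally show ?thesis .
qed

definition caching_pir ::
    "nat \<Rightarrow> caching_scheme \<Rightarrow> nat \<Rightarrow> nat \<Rightarrow> bool list pmf \<Rightarrow> bool list pmf \<Rightarrow> pir_scheme" where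
  "caching_pir N C l r K L = \<lparr>
     pir_subpacketization = cc_subpacketization C,
     pir_query = caching_query N K L,
     pir_answer1 = (\<lambda>q S. case from_nat q of (i, k) \<Rightarrow> pad l (cc_place C i S) @ k),
     pir_answer2 = (\<lambda>q S. case from_nat q of (c, k) \<Rightarrow> pad r (cc_deliver C (cyclic_demand N c) S) @ k)\<rparr>"

section \<open>Raising the answer entropy to a prescribed value\<close>

lemma shannon_append:
  fixes U :: "'i pmf" and K :: "bool list pmf" and D :: "'w pmf"
  assumes "finite (set_pmf U)" "finite (set_pmf K)" "finite (set_pmf D)"
    and len: "\<And>i w. i \<in> set_pmf U \<Longrightarrow> w \<in> set_pmf D \<Longrightarrow> length (f i w) = l"
  shows "shannon (map_pmf (\<lambda>((i, k), w). f i w @ k) (pair_pmf (pair_pmf U K) D))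
    = shannon (map_pmf (\<lambda>(i, w). f i w) (pair_pmf U D)) + shannon K"
proof -
  let ?Z = "map_pmf (\<lambda>(i, w). f i w) (pair_pmf U D)"
  have "map_pmf (\<lambda>((i, k), w). f i w @ k) (pair_pmf (pair_pmf U K) D)
      = map_pmf (\<lambda>(z, k). z @ k) (pair_pmf ?Z K)"
    unfolding pair_pmf_def map_pmf_def
    by (simp add: bind_assoc_pmf bind_return_pmf) (subst bind_commute_pmf[of K], rule refl)
  \<comment> \<open>All contents have the same length \<open>l\<close>, so the cut between content
    and key is determined. The concatenation therefore loses nothing and the two entropies
    add.\<close>
  moreover have "inj_on (\<lambda>(z, k). z @ k) (set_pmf (pair_pmf ?Z K))"
    using len by (auto simp: inj_on_def)
  ultimately show ?thesis
    using assms by (simp add: shannon_map_inj shannon_pair)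
qed

text \<open>All values of \<open>f\<close> lie in {0,1}^l, so even with a random index their entropy
  is at most \<open>l\<close>, hence at most \<open>x\<close>. The key supplies the missing
  amount.\<close>

lemma exact_padding:
  fixes f :: "nat \<Rightarrow> bool list list \<Rightarrow> bool list"
  assumes "N \<ge> 1" and len: "\<And>i W. i < N \<Longrightarrow> W \<in> databases N B \<Longrightarrow> length (f i W) = l"
    and "real l \<le> x"
  obtains K where "finite (set_pmf K)"
    "shannon (map_pmf (\<lambda>((i, k), W). f i W @ k)
       (pair_pmf (pair_pmf (pmf_of_set {0..<N}) K) (pmf_of_set (databases N B)))) = x"
proof -
  let ?D = "pmf_of_set (databases N B)" and ?U = "pmf_of_set {0..<N}"
  have D: "set_pmf ?D = databases N B"
    by (simp add: finite_databases databases_nonempty)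
  have U: "set_pmf ?U = {0..<N}" using assms by simp
  define h where "h = shannon (map_pmf (\<lambda>(i, W). f i W) (pair_pmf ?U ?D))"
  have fin: "finite {z :: bool list. length z = m}" for m
    using finite_lists_length_eq[of "UNIV :: bool set" m] by simp
  have "h \<le> log 2 (card {z :: bool list. length z = l})"
    unfolding h_def using len
    by (intro shannon_le_log_card fin) (auto simp: D U simp del: set_pmf_of_set)
  also have "\<dots> = real l"
    using card_lists_length_eq[of "UNIV :: bool set" l] by simp
  finally have "0 \<le> x - h" using \<open>real l \<le> x\<close> by simp
  moreover obtain n where "x - h \<le> real n" using real_arch_simple by blast
  ultimately obtain K :: "bool list pmf" where K: "set_pmf K \<subseteq> {k. length k = n}" "shannon K = x - h"
    using ex_pmf_shannon by blast
  have "finite (set_pmf K)" using K(1) fin finite_subset by blast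
  moreover from this have "shannon (map_pmf (\<lambda>((i, k), W). f i W @ k) (pair_pmf (pair_pmf ?U K) ?D)) = x"
    using len K(2)
    by (subst shannon_append[where l = l]) (auto simp: D U h_def finite_databases simp del: set_pmf_of_set)
  ultimately show thesis by (rule that)
qed

lemma finite_set_caching_query:
  assumes "N \<ge> 1" "finite (set_pmf K)" "finite (set_pmf L)"
  shows "finite (set_pmf (caching_query N K L d))"
  using assms by (simp add: caching_query_def)

section \<open>Privacy and independence of the queries\<close>

lemma finite_set_pir_joint:
  assumes "\<And>d. d < N \<Longrightarrow> finite (set_pmf (pir_query P d))" "set_pmf p \<subseteq> {0..<N}"
  shows "finite (set_pmf (pir_joint N B P p))"
proof -
  have "finite (set_pmf p)" using assms(2) finite_subset by blast
  moreover have "finite (set_pmf (pir_query P d))" if "d \<in> set_pmf p" for d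
    using that assms by auto
  ultimately show ?thesis
    unfolding pir_joint_eq by (auto simp: finite_databases databases_nonempty)
qed

text \<open>If the first query has the same law \<open>q\<close> for every demand, then demand and
  query form a product law, and the files are independent of both.\<close>

lemma demand_indep_query1:
  assumes "set_pmf p \<subseteq> {0..<N}" "\<And>d. d < N \<Longrightarrow> map_pmf fst (pir_query P d) = q"
  shows "pmf_cond_mutual_information (pir_joint N B P p) rv_demand rv_query1 rv_files = 0"
proof -
  let ?G = "bind_pmf p (\<lambda>d. map_pmf (Pair d) (pir_query P d))"
  have "map_pmf (\<lambda>g. (fst g, fst (snd g))) ?G
      = bind_pmf p (\<lambda>d. map_pmf (Pair d) (map_pmf fst (pir_query P d)))"
    by (simp add: map_bind_pmf map_pmf_comp)
  also have "\<dots> = bind_pmf p (\<lambda>d. map_pmf (Pair d) q)"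
    using assms by (intro bind_pmf_cong refl) auto
  also have "\<dots> = pair_pmf p q"
    by (simp add: pair_pmf_def map_pmf_def)
  finally show ?thesis
    unfolding pir_joint_eq
    by (intro pmf_cond_mutual_information_eq_0[where p = p and q = q and r = "pmf_of_set (databases N B)"])
       (simp add: map_pair_pmf_indep[symmetric] map_pmf_comp rv_demand_def rv_query1_def rv_files_def
          split_def)
qed

lemma demand_indep_query2:
  assumes "set_pmf p \<subseteq> {0..<N}" "\<And>d. d < N \<Longrightarrow> map_pmf snd (pir_query P d) = q"
  shows "pmf_cond_mutual_information (pir_joint N B P p) rv_demand rv_query2 rv_files = 0"
proof -
  let ?G = "bind_pmf p (\<lambda>d. map_pmf (Pair d) (pir_query P d))"
  have "map_pmf (\<lambda>g. (fst g, snd (snd g))) ?G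
      = bind_pmf p (\<lambda>d. map_pmf (Pair d) (map_pmf snd (pir_query P d)))"
    by (simp add: map_bind_pmf map_pmf_comp)
  also have "\<dots> = bind_pmf p (\<lambda>d. map_pmf (Pair d) q)"
    using assms by (intro bind_pmf_cong refl) auto
  also have "\<dots> = pair_pmf p q"
    by (simp add: pair_pmf_def map_pmf_def)
  finally show ?thesis
    unfolding pir_joint_eq
    by (intro pmf_cond_mutual_information_eq_0[where p = p and q = q and r = "pmf_of_set (databases N B)"])
       (simp add: map_pair_pmf_indep[symmetric] map_pmf_comp rv_demand_def rv_query2_def rv_files_def
          split_def)
qed

lemma map_queries_files:
  "map_pmf (\<lambda>\<omega>. (rv_query1 \<omega>, rv_query2 \<omega>, rv_files \<omega>)) (pir_joint N B P p)
    = map_pmf (\<lambda>((q1, q2), W). (q1, q2, W))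
        (pair_pmf (bind_pmf p (pir_query P)) (pmf_of_set (databases N B)))"
proof -
  have "bind_pmf p (pir_query P)
      = map_pmf snd (bind_pmf p (\<lambda>d. map_pmf (Pair d) (pir_query P d)))"
    by (simp add: map_bind_pmf map_pmf_comp)
  then show ?thesis
    by (simp add: pir_joint_eq pair_map_pmf1 map_pmf_comp rv_query1_def rv_query2_def rv_files_def
        split_def)
qed

lemma independent_queries:
  assumes "bind_pmf (pmf_of_set {0..<N}) (pir_query P) = pair_pmf q1 q2"
  shows "map_pmf (\<lambda>\<omega>. (rv_query1 \<omega>, rv_query2 \<omega>, rv_files \<omega>)) (pir_uniform_joint N B P)
    = pair_pmf q1 (pair_pmf q2 (pmf_of_set (databases N B)))"
  unfolding pir_uniform_joint_def map_queries_files assms pair_pair_pmf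
  by (simp add: map_pmf_comp split_def)

theorem theorem6:
  fixes N B F :: nat and M R :: real
  assumes "N \<ge> 1" and "B \<ge> 1"
    and "\<exists>C. coded_caching N N B C \<and> achieves_memory_load N N B C M R \<and>
             cc_subpacketization C = F"
  shows "\<exists>P. two_server_pir N B P \<and> UDIQ N B P \<and>
             download_cost1 N B P = M \<and> download_cost2 N B P = R \<and>
             pir_subpacketization P = F"
proof -
  obtain C where C: "coded_caching N N B C" "achieves_memory_load N N B C M R"
    and F: "cc_subpacketization C = F" using assms(3) by blast
  have sub: "subpacketization_ok B F" using C(1) F by (simp add: coded_caching_def)
  have dec: "cc_decode C i d (broadcast C d W) (cache_content C i W) = packets F (W ! (d ! i))"
    if "d \<in> demand_vectors N N" "i < N" "W \<in> databases N B" for d i W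
    using C(1) F that by (simp add: coded_caching_def)
  obtain lz where lz: "\<And>i. i < N \<Longrightarrow> real (lz i) \<le> M * real B"
    "\<And>i W. i < N \<Longrightarrow> W \<in> databases N B \<Longrightarrow> length (cache_content C i W) = lz i"
    using C(2) unfolding achieves_memory_load_def by metis
  obtain lx where lx: "\<And>d. d \<in> demand_vectors N N \<Longrightarrow> real (lx d) \<le> R * real B"
    "\<And>d W. d \<in> demand_vectors N N \<Longrightarrow> W \<in> databases N B \<Longrightarrow> length (broadcast C d W) = lx d"
    using C(2) unfolding achieves_memory_load_def by metis
  \<comment> \<open>Lengths are integers, so every cache length bounded by \<open>M * real B\<close>
    is also bounded by its floor; this is the common length to pad to.\<close>
  define l where "l = nat \<lfloor>M * real B\<rfloor>"
  define r where "r = nat \<lfloor>R * real B\<rfloor>"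
  note cyc = cyclic_demand_in[OF \<open>N \<ge> 1\<close>]
  \<comment> \<open>Since \<open>N \<ge> 1\<close>, user 0 exists and its cache has nonnegative
    length. Without the sign, \<open>nat\<close> of the floor could exceed the bound.\<close>
  have "0 \<le> M * real B" using lz(1)[of 0] assms(1) by (simp add: order_trans[OF of_nat_0_le_iff])
  then have l: "real l \<le> M * real B" by (simp add: l_def)
  have "0 \<le> R * real B" using lx(1)[OF cyc[of 0]] by (simp add: order_trans[OF of_nat_0_le_iff])
  then have r: "real r \<le> R * real B" by (simp add: r_def)
  have lz_le: "lz i \<le> l" if "i < N" for i
    using lz(1)[OF that] unfolding l_def by linarith
  have lx_le: "lx d \<le> r" if "d \<in> demand_vectors N N" for d
    using lx(1)[OF that] unfolding r_def by linarith
  let ?f = "\<lambda>i W. pad l (cache_content C i W)"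
  let ?g = "\<lambda>c W. pad r (broadcast C (cyclic_demand N c) W)"
  \<comment> \<open>The target is \<open>M * real B\<close> bits because the download cost is
    normalized by the file length.\<close>
  obtain K where K: "finite (set_pmf K)"
    "shannon (map_pmf (\<lambda>((i, k), W). ?f i W @ k)
       (pair_pmf (pair_pmf (pmf_of_set {0..<N}) K) (pmf_of_set (databases N B)))) = M * real B"
    by (rule exact_padding[OF assms(1) _ l, of B ?f]) (simp_all add: length_pad lz lz_le)
  obtain L where L: "finite (set_pmf L)"
    "shannon (map_pmf (\<lambda>((i, k), W). ?g i W @ k)
       (pair_pmf (pair_pmf (pmf_of_set {0..<N}) L) (pmf_of_set (databases N B)))) = R * real B"
    by (rule exact_padding[OF assms(1) _ r, of B ?g]) (simp_all add: length_pad lx cyc lx_le)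
  define P where "P = caching_pir N C l r K L"
  have query: "pir_query P = caching_query N K L" and subP: "pir_subpacketization P = F"
    by (simp_all add: P_def caching_pir_def F)
  have ans1: "pir_answer1 P (to_nat (i, k)) (map (packets F) W) = ?f i W @ k" for i k W
    by (simp add: P_def caching_pir_def cache_content_def F)
  have ans2: "pir_answer2 P (to_nat (c, k)) (map (packets F) W) = ?g c W @ k" for c k W
    by (simp add: P_def caching_pir_def broadcast_def F)
  have fin: "finite (set_pmf (pir_joint N B P p))" if "set_pmf p \<subseteq> {0..<N}" for p
    using that assms(1) K L by (intro finite_set_pir_joint) (simp_all add: query finite_set_caching_query)
  have correct: "pmf_cond_entropy (pir_joint N B P p) rv_desired
          (\<lambda>\<omega>. (rv_answer1 P \<omega>, rv_answer2 P \<omega>, rv_query1 \<omega>, rv_query2 \<omega>)) = 0"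
    if p: "set_pmf p \<subseteq> {0..<N}" for p
  proof (rule pmf_cond_entropy_eq_0[OF fin[OF p]])
    \<comment> \<open>The queries reveal the caching user and the demand vector, hence also the
      unpadded lengths \<open>lz i\<close> and \<open>lx v\<close>. After cutting, the caching
      decoder returns packets, which are concatenated to the file.\<close>
    let ?decode = "\<lambda>(a1, a2, q1, q2).
      let i = fst (from_nat q1 :: nat \<times> bool list);
          v = cyclic_demand N (fst (from_nat q2 :: nat \<times> bool list))
      in concat (cc_decode C i v (take (lx v) a2) (take (lz i) a1))"
    fix \<omega> assume "\<omega> \<in> set_pmf (pir_joint N B P p)"
    then obtain d W q where \<omega>': "\<omega> = (d, W, q)" and d: "d < N" and W: "W \<in> databases N B"
      and q: "q \<in> set_pmf (caching_query N K L d)"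
      using p by (fastforce simp: pir_joint_def query finite_databases databases_nonempty)
    from q obtain z where z: "z \<in> set_pmf (pair_pmf (pmf_of_set {0..<N}) (pair_pmf K L))"
      and "q = (\<lambda>(i, k, k'). (to_nat (i, k), to_nat ((d + (N - i)) mod N, k'))) z"
      unfolding caching_query_def set_map_pmf by (elim imageE)
    moreover obtain i k k' where "z = (i, k, k')" by (rule prod_cases3)
    moreover from this z have i: "i < N" using assms(1) by simp
    \<comment> \<open>Every outcome of positive probability has this form, so that entry
      \<open>i\<close> of the decoded demand vector is \<open>d\<close>.\<close>
    ultimately have \<omega>: "\<omega> = (d, W, to_nat (i, k), to_nat ((d + (N - i)) mod N, k'))"
      using \<omega>' by simp
    have "W ! d \<in> set W" "set W \<subseteq> {w. length w = B}"
      using W d by (auto simp: databases_def)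
    then have "length (W ! d) = B" by (auto simp del: nth_mem)
    then have "concat (packets F (W ! d)) = W ! d"
      using sub by (simp add: concat_packets subpacketization_ok_def)
    then show "rv_desired \<omega> = ?decode (rv_answer1 P \<omega>, rv_answer2 P \<omega>, rv_query1 \<omega>, rv_query2 \<omega>)"
      using d i W unfolding \<omega>
      by (simp add: rv_desired_def rv_answer1_def rv_answer2_def rv_query1_def rv_query2_def subP
          ans1 ans2 Let_def take_pad lz lx cyc dec cyclic_demand_nth
          del: take_append add_diff_assoc)
  qed
  have "two_server_pir N B P"
    unfolding two_server_pir_def subP
    using sub assms(1) K(1) L(1) correct
    by (auto intro!: demand_indep_query1[where q = "key_query N K"] demand_indep_query2[where q = "key_query N L"]
        simp: query finite_set_caching_query map_fst_caching_query map_snd_caching_query)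
  \<comment> \<open>Besides UDIQ, this product form supplies the law of each single query, from
    which both download costs are computed.\<close>
  moreover have joint: "map_pmf (\<lambda>\<omega>. (rv_query1 \<omega>, rv_query2 \<omega>, rv_files \<omega>)) (pir_uniform_joint N B P)
      = pair_pmf (key_query N K) (pair_pmf (key_query N L) (pmf_of_set (databases N B)))"
    using assms(1) by (intro independent_queries) (simp add: query caching_query_uniform)
  moreover have "UDIQ N B P"
    unfolding UDIQ_def by (rule pmf_cond_mutual_information_eq_0[OF joint])
  moreover have finU: "finite (set_pmf (pir_uniform_joint N B P))"
    unfolding pir_uniform_joint_def using assms(1) by (intro fin) simp
  moreover have "download_cost1 N B P = M"
  proof -
    have "map_pmf (rv_answer1 P) (pir_uniform_joint N B P)
       = map_pmf (\<lambda>(q1, q2, W). pir_answer1 P q1 (map (packets F) W))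
           (pair_pmf (key_query N K) (pair_pmf (key_query N L) (pmf_of_set (databases N B))))"
      unfolding joint[symmetric]
      by (simp add: map_pmf_comp rv_answer1_def rv_query1_def rv_query2_def rv_files_def subP split_def)
    \<comment> \<open>Answer 1 ignores the second query, which is integrated out; the first one is
      decoded into its index and key.\<close>
    also have "\<dots> = map_pmf (\<lambda>((i, k), W). ?f i W @ k)
       (pair_pmf (pair_pmf (pmf_of_set {0..<N}) K) (pmf_of_set (databases N B)))"
      unfolding key_query_def pair_pmf_def map_pmf_def
      by (simp add: bind_assoc_pmf bind_return_pmf ans1)
    finally show ?thesis
      using assms(2) K(2) by (simp add: download_cost1_def pmf_entropy_eq_shannon[OF finU])
  qed
  moreover have "download_cost2 N B P = R"
  proof -
    have "map_pmf (rv_answer2 P) (pir_uniform_joint N B P)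
       = map_pmf (\<lambda>(q1, q2, W). pir_answer2 P q2 (map (packets F) W))
           (pair_pmf (key_query N K) (pair_pmf (key_query N L) (pmf_of_set (databases N B))))"
      unfolding joint[symmetric]
      by (simp add: map_pmf_comp rv_answer2_def rv_query1_def rv_query2_def rv_files_def subP split_def)
    also have "\<dots> = map_pmf (\<lambda>((i, k), W). ?g i W @ k)
       (pair_pmf (pair_pmf (pmf_of_set {0..<N}) L) (pmf_of_set (databases N B)))"
      unfolding key_query_def pair_pmf_def map_pmf_def
      by (simp add: bind_assoc_pmf bind_return_pmf ans2)
    \<comment> \<open>Dividing \<open>R * real B\<close> by \<open>B\<close> gives exactly
      \<open>R\<close>, as \<open>B \<ge> 1\<close>.\<close>
    finally show ?thesis
      using assms(2) L(2) by (simp add: download_cost2_def pmf_entropy_eq_shannon[OF finU])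
  qed
  ultimately show ?thesis using subP by blast
qed

end
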